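(* Let $p$ be a prime, $\mathbb{F}=\mathbb{F}_p$, and let $n\ge 1$ be an integer. There is a basis for $\mathrm{Poly}(\mathbb{F}^n\to\mathbb{T})$ consisting only of homogeneous (non-classical) polynomials. That is, there is a family $(h_b)_{b\in B}$ of homogeneous polynomials $h_b\in\mathrm{Poly}(\mathbb{F}^n\to\mathbb{T})$ such that every $P\in \mathrm{Poly}(\mathbb{F}^n\to\mathbb{T})$ can be written as a finite sum $P=\sum_{b\in B} c_b h_b$ for a unique choice of finitely supported coefficients $c_b\in\{0,1,\dots,p-1\}$.
   Context: $\mathbb{T}=\mathbb{R}/\mathbb{Z}$ is the circle group, written additively; for an integer $m$ and $t\in\mathbb{T}$, $mt$ denotes the usual integer multiple. $|\cdot|$ denotes the standard map from $\mathbb{F}$ to $\{0,1,\dots,p-1\}\subset\mathbb{Z}$. For $P:\mathbb{F}^n\to\mathbb{T}$ and $h\in\mathbb{F}^n$, $D_hP(x)=P(x+h)-P(x)$. A function $P:\mathbb{F}^n\to\mathbb{T}$ is a (non-classical) polynomial of degree $\le d$ if $D_{y_1}\cdots D_{y_{d+1}}P(x)=0$ for all $y_1,\dots,y_{d+1},x\in\mathbb{F}^n$. Known structure (Tao--Ziegler): $P$ is a polynomial of degree $\le d$ if and only if $$P(x_1,\dots,x_n)=\alpha+\sum_{\substack{0\le d_1,\dots,d_n<p,\ k\ge 0\\ 0<\sum_i d_i\le d-k(p-1)}}\frac{c_{d_1,\dots,d_n,k}|x_1|^{d_1}\cdots|x_n|^{d_n}}{p^{k+1}} \bmod 1$$ for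 a unique choice of $c_{d_1,\dots,d_n,k}\in\{0,1,\dots,p-1\}$ and $\alpha\in\mathbb{T}$; $\alpha$ is called the shift of $P$. Convention: all polynomials are assumed to have shift $0$, and $\mathrm{Poly}(\mathbb{F}^n\to\mathbb{T})$ denotes the set of all such polynomials (of any degree). A polynomial $P:\mathbb{F}^n\to\mathbb{T}$ is called homogeneous if for every $c\in\mathbb{F}$ there exists $\sigma_c\in\mathbb{Z}$ such that $P(cx)=\sigma_cP(x)$ in $\mathbb{T}$ for all $x\in\mathbb{F}^n$. *)

theory Defs
  imports "HOL-Analysis.Analysis" "Berlekamp_Zassenhaus.Finite_Field"
begin

section \<open>The circle group\<close>

quotient_type circle = real / "\<lambda>x y :: real. x - y \<in> \<int>"
proof (rule equivpI)
  show "reflp (\<lambda>x y :: real. x - y \<in> \<int>)"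
    by (simp add: reflp_def)
  show "symp (\<lambda>x y :: real. x - y \<in> \<int>)"
    by (rule sympI) (metis Ints_minus minus_diff_eq)
  show "transp (\<lambda>x y :: real. x - y \<in> \<int>)"
    by (rule transpI) (metis Ints_add diff_add_cancel add_diff_eq)
qed

instantiation circle :: ab_group_add
begin

lift_definition zero_circle :: circle is "0 :: real" .

lift_definition plus_circle :: "circle \<Rightarrow> circle \<Rightarrow> circle" is "(+) :: real \<Rightarrow> _"
  by (metis Ints_add add_diff_add)

lift_definition uminus_circle :: "circle \<Rightarrow> circle" is "uminus :: real \<Rightarrow> _"
  by (metis Ints_minus minus_diff_minus)

lift_definition minus_circle :: "circle \<Rightarrow> circle \<Rightarrow> circle" is "(-) :: real \<Rightarrow> _"
proof -
  fix a b c d :: real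
  assume "a - b \<in> \<int>" "c - d \<in> \<int>"
  then have "(a - b) - (c - d) \<in> \<int>" by (rule Ints_diff)
  then show "(a - c) - (b - d) \<in> \<int>" by (simp add: algebra_simps)
qed

instance
  by standard (transfer; simp add: algebra_simps)+

end

lift_definition mod1 :: "real \<Rightarrow> circle" is "\<lambda>x. x" .

lift_definition int_multiple :: "int \<Rightarrow> circle \<Rightarrow> circle" (infixr \<open>*\<^sub>\<int>\<close> 75)
  is "\<lambda>m x. of_int m * x"
  by (metis Ints_mult Ints_of_int right_diff_distrib)

lemma module_int_multiple: "Modules.module int_multiple"
  by standard (transfer; simp add: algebra_simps)+


section \<open>Non-classical polynomials\<close>

text \<open>The class \<^class>\<open>prime_card\<close> makes \<open>'p mod_ring\<close> the prime field with \<open>CARD('p)\<close> elements,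
  and \<^const>\<open>to_int_mod_ring\<close> is its standard map onto \<open>{0..<CARD('p)}\<close>.\<close>

definition diff_op ::
    "'p::prime_card mod_ring ^ 'n \<Rightarrow> ('p mod_ring ^ 'n \<Rightarrow> circle) \<Rightarrow> ('p mod_ring ^ 'n \<Rightarrow> circle)" where
  "diff_op h P = (\<lambda>x. P (x + h) - P x)"

definition poly_deg_le :: "nat \<Rightarrow> ('p::prime_card mod_ring ^ 'n \<Rightarrow> circle) \<Rightarrow> bool" where
  "poly_deg_le d P \<longleftrightarrow> (\<forall>ys x. length ys = d + 1 \<longrightarrow> foldr diff_op ys P x = 0)"

text \<open>The pairs \<open>(e, k)\<close> with \<open>0 < \<Sum>i. e i \<le> d - k * (p - 1)\<close>; the inequality is rearranged to
  avoid truncated subtraction.\<close>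

definition exponents :: "nat \<Rightarrow> nat \<Rightarrow> (('n::finite \<Rightarrow> nat) \<times> nat) set" where
  "exponents p d = {(e, k). (\<forall>i. e i < p) \<and> 0 < (\<Sum>i\<in>UNIV. e i) \<and>
     (\<Sum>i\<in>UNIV. e i) + k * (p - 1) \<le> d}"

definition expansion ::
    "nat \<Rightarrow> (('n::finite \<Rightarrow> nat) \<Rightarrow> nat \<Rightarrow> nat) \<Rightarrow> 'p::prime_card mod_ring ^ 'n \<Rightarrow> real" where
  "expansion d c x = (\<Sum>(e, k)\<in>exponents CARD('p) d.
     real (c e k) * (\<Prod>i\<in>UNIV. real_of_int (to_int_mod_ring (x $ i)) ^ e i) / real CARD('p) ^ (k + 1))"

text \<open>By the Tao--Ziegler structure theorem every polynomial has such an expansion, and the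
  constant term does not depend on the degree bound \<open>d\<close>.\<close>

definition poly_shift :: "('p::prime_card mod_ring ^ 'n::finite \<Rightarrow> circle) \<Rightarrow> circle" where
  "poly_shift P = (THE \<alpha>. \<exists>d c. (\<forall>e k. c e k \<in> {0..<CARD('p)}) \<and>
     (\<forall>x. P x = \<alpha> + mod1 (expansion d c x)))"

definition nc_Poly :: "('p::prime_card mod_ring ^ 'n::finite \<Rightarrow> circle) set" where
  "nc_Poly = {P. (\<exists>d. poly_deg_le d P) \<and> poly_shift P = 0}"

definition homogeneous :: "('p::prime_card mod_ring ^ 'n \<Rightarrow> circle) \<Rightarrow> bool" where
  "homogeneous P \<longleftrightarrow> (\<forall>c. \<exists>\<sigma>::int. \<forall>x. P (c *s x) = \<sigma> *\<^sub>\<int> P x)"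

lemma expansion_0: "expansion d c (0 :: 'p::prime_card mod_ring ^ 'n::finite) = 0"
proof -
  have "(\<Prod>i\<in>UNIV. real_of_int (to_int_mod_ring ((0 :: 'p mod_ring ^ 'n) $ i)) ^ e i) = 0"
    if "(e, k) \<in> exponents CARD('p) d" for e :: "'n \<Rightarrow> nat" and k
  proof -
    from that obtain i where "e i \<noteq> 0"
      by (metis (mono_tags, lifting) exponents_def case_prod_conv less_irrefl mem_Collect_eq sum.neutral)
    then have "real_of_int (to_int_mod_ring ((0 :: 'p mod_ring ^ 'n) $ i)) ^ e i = 0"
      by simp
    then show ?thesis
      by (meson UNIV_I finite prod_zero)
  qed
  then show ?thesis
    unfolding expansion_def by (intro sum.neutral) auto
qed

lemma poly_shift_eqI:
  fixes P :: "'p::prime_card mod_ring ^ 'n::finite \<Rightarrow> circle"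
  assumes "\<forall>e k. c e k \<in> {0..<CARD('p)}" "\<forall>x. P x = \<alpha> + mod1 (expansion d c x)"
  shows "poly_shift P = \<alpha>"
proof -
  have 0: "mod1 0 = 0" by transfer simp
  show ?thesis
    unfolding poly_shift_def
    by (rule the_equality) (use assms in blast, metis assms(2) expansion_0 0 add.right_neutral)
qed

end

theory Submission
  imports Defs
begin

text \<open>
  A polynomial of degree at most \<open>d\<close> is, up to its value at the origin, a function whose values are killed by
  \<open>p\<^sup>d\<close>; conversely every function \<open>F\<^sup>n \<rightarrow> T\<close> of bounded \<open>p\<close>-power torsion has finite degree, because
  \<open>p\<close>-fold differencing in a fixed direction kills \<open>p\<close>-torsion functions and long lists of directions
  contain repetitions. So the polynomials of shift zero are exactly the functions of bounded
  \<open>p\<close>-power torsion that vanish at the origin (\<open>nc_Poly_iff\<close>).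

  The part of this group killed by \<open>p\<close> consists of the functions \<open>F\<^sup>n \<rightarrow> F\<close> vanishing at the origin, and the
  nonconstant monomials \<open>x\<^sup>v\<close> with exponents below \<open>p\<close> are a basis of it over \<open>F\<close>. Suppose that for
  each such \<open>v\<close> and each \<open>k\<close> a function vanishing at the origin is given whose \<open>p\<^sup>k\<close>-fold multiple is
  \<open>x\<^sup>v / p\<close>. Peeling off one power of \<open>p\<close> at a time, every function in the group is a unique
  combination of these functions with digits in \<open>{0,\<dots>,p - 1}\<close> (\<open>digit_expansion_exists\<close>,
  \<open>digit_expansion_unique\<close>).

  The monomials \<open>|x|\<^sup>v / p\<^sup>k\<^sup>+\<^sup>1\<close> are such a family, which recovers the Tao--Ziegler expansion and with it
  the value of the shift. They need not be homogeneous, as \<open>|c x|\<close> agrees with \<open>|c| |x|\<close> only modulo \<open>p\<close>.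
  Raising the numerator to the power \<open>p ^ k\<close> repairs this: a congruence modulo \<open>p\<close> becomes one modulo
  \<open>p\<^sup>k\<^sup>+\<^sup>1\<close>, while modulo \<open>p\<close> the numerator is unchanged by the little Fermat theorem. The functions
  \<open>(|x|\<^sup>v) ^ p ^ k / p\<^sup>k\<^sup>+\<^sup>1\<close> therefore form the required homogeneous basis.
\<close>

section \<open>Integer multiples and fractions in the circle group\<close>

interpretation int_multiple: Modules.module int_multiple
  by (rule module_int_multiple)

lemma mod1_0: "mod1 0 = 0"
  by transfer simp

lemma mod1_add: "mod1 (a + b) = mod1 a + mod1 b"
  by transfer simp

lemma mod1_sum: "mod1 (\<Sum>i\<in>A. f i) = (\<Sum>i\<in>A. mod1 (f i))"
  by (induction A rule: infinite_finite_induct) (simp_all add: mod1_0 mod1_add)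

lemma int_multiple_mod1: "m *\<^sub>\<int> mod1 r = mod1 (of_int m * r)"
  by transfer simp

lemma mod1_eq_iff: "mod1 a = mod1 b \<longleftrightarrow> a - b \<in> \<int>"
  by transfer simp

lemma mod1_surj: "\<exists>r. t = mod1 r"
  by transfer (metis Ints_0 diff_self)

definition circle_frac :: "int \<Rightarrow> int \<Rightarrow> circle" where
  "circle_frac m q = mod1 (of_int m / of_int q)"

lemma circle_frac_eq_iff:
  assumes "q > 0"
  shows "circle_frac a q = circle_frac b q \<longleftrightarrow> [a = b] (mod q)"
proof -
  have "real_of_int a / of_int q - of_int b / of_int q = of_int z \<longleftrightarrow> a - b = q * z" for z
  proof -
    have "real_of_int a / of_int q - of_int b / of_int q = of_int z
      \<longleftrightarrow> real_of_int (a - b) = of_int (q * z)"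
      using assms by (simp add: field_simps)
    then show ?thesis
      by (simp only: of_int_eq_iff)
  qed
  then show ?thesis
    by (auto simp: circle_frac_def mod1_eq_iff Ints_def cong_iff_dvd_diff dvd_def)
qed

lemma circle_frac_0: "circle_frac 0 q = 0"
  by (simp add: circle_frac_def mod1_0)

lemma int_multiple_circle_frac: "m *\<^sub>\<int> circle_frac a q = circle_frac (m * a) q"
  by (simp add: circle_frac_def int_multiple_mod1)

lemma circle_frac_sum: "circle_frac (\<Sum>i\<in>A. f i) q = (\<Sum>i\<in>A. circle_frac (f i) q)"
  by (simp add: circle_frac_def sum_divide_distrib mod1_sum)

lemma circle_frac_cancel: "c \<noteq> 0 \<Longrightarrow> circle_frac (c * a) (c * q) = circle_frac a q"
  by (simp add: circle_frac_def)

lemma torsion_imp_circle_frac: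
  assumes "q > 0" "q *\<^sub>\<int> t = 0"
  shows "\<exists>m. t = circle_frac m q"
proof -
  obtain r where r: "t = mod1 r"
    using mod1_surj by blast
  then have "of_int q * r \<in> \<int>"
    using assms(2) mod1_eq_iff[of _ 0] by (simp add: int_multiple_mod1 mod1_0)
  then obtain m where "of_int q * r = of_int m"
    by (auto elim: Ints_cases)
  then have "r = of_int m / of_int q"
    using assms(1) by (simp add: field_simps)
  then show ?thesis
    using r by (auto simp: circle_frac_def)
qed

section \<open>Torsion and bounded degree\<close>

lemma diff_op_commute: "diff_op h (diff_op k P) = diff_op k (diff_op h P)"
  by (simp add: diff_op_def algebra_simps fun_eq_iff)

lemma diff_op_int_multiple:
  "diff_op h (\<lambda>x. m *\<^sub>\<int> P x) = (\<lambda>x. m *\<^sub>\<int> diff_op h P x)"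
  by (simp add: diff_op_def int_multiple.scale_right_diff_distrib)

lemma foldr_diff_op_int_multiple:
  "foldr diff_op ys (\<lambda>x. m *\<^sub>\<int> P x) = (\<lambda>x. m *\<^sub>\<int> foldr diff_op ys P x)"
  by (induction ys) (simp_all add: diff_op_int_multiple)

lemma foldr_diff_op_0: "foldr diff_op ys (\<lambda>x. 0) = (\<lambda>x. 0)"
  by (induction ys) (simp_all add: diff_op_def)

text \<open>Difference operators commute, so an iterated derivative depends only on the multiset of
  directions. This allows equal directions to be collected.\<close>

lemma foldr_diff_op_mset_eq:
  assumes "mset ys = mset zs"
  shows "foldr diff_op ys P = foldr diff_op zs P"
proof -
  have "fold diff_op ys = fold diff_op zs"
    by (rule fold_multiset_equiv) (use assms in \<open>auto simp: diff_op_commute\<close>)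
  moreover have "foldr diff_op xs = fold diff_op xs" for xs :: "('a mod_ring ^ 'b) list"
    by (rule foldr_fold) (auto simp: diff_op_commute)
  ultimately show ?thesis
    by simp
qed

lemma sum_binomial_Suc:
  fixes a :: "nat \<Rightarrow> circle"
  shows "(\<Sum>i\<le>Suc m. int (Suc m choose i) *\<^sub>\<int> a i) = (\<Sum>i\<le>m. int (m choose i) *\<^sub>\<int> (a i + a (Suc i)))"
proof -
  have "(\<Sum>i\<le>Suc m. int (Suc m choose i) *\<^sub>\<int> a i)
      = a 0 + (\<Sum>i\<le>m. int (m choose Suc i) *\<^sub>\<int> a (Suc i)) + (\<Sum>i\<le>m. int (m choose i) *\<^sub>\<int> a (Suc i))"
    by (simp add: sum.atMost_Suc_shift int_multiple.scale_left_distrib sum.distrib del: sum.atMost_Suc)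
  also have "a 0 + (\<Sum>i\<le>m. int (m choose Suc i) *\<^sub>\<int> a (Suc i)) = (\<Sum>i\<le>Suc m. int (m choose i) *\<^sub>\<int> a i)"
    by (simp add: sum.atMost_Suc_shift del: sum.atMost_Suc)
  also have "\<dots> = (\<Sum>i\<le>m. int (m choose i) *\<^sub>\<int> a i)"
    by (simp add: binomial_eq_0)
  finally show ?thesis
    by (simp add: int_multiple.scale_right_distrib sum.distrib)
qed

text \<open>The translation by \<open>y\<close> is \<open>1 + diff_op y\<close>, and the binomial theorem expands its
  \<open>m\<close>-th power. Expanding translations in differences, and not the converse, avoids alternating signs, which
  would need a separate treatment of \<open>p = 2\<close> below.\<close>

lemma shift_eq_sum_diff_op:
  "P (x + of_nat m *s y) = (\<Sum>i\<le>m. int (m choose i) *\<^sub>\<int> (diff_op y ^^ i) P x)"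
proof (induction m arbitrary: x)
  case 0
  show ?case by simp
next
  case (Suc m)
  have "P (x + of_nat (Suc m) *s y) = P ((x + y) + of_nat m *s y)"
    by (simp add: vector_sadd_rdistrib algebra_simps)
  also have "\<dots> = (\<Sum>i\<le>m. int (m choose i) *\<^sub>\<int> ((diff_op y ^^ i) P x + (diff_op y ^^ Suc i) P x))"
    unfolding Suc.IH by (simp add: diff_op_def)
  finally show ?case
    unfolding sum_binomial_Suc .
qed

lemma diff_op_power_int_multiple:
  "(diff_op y ^^ i) (\<lambda>x. m *\<^sub>\<int> P x) = (\<lambda>x. m *\<^sub>\<int> (diff_op y ^^ i) P x)"
  by (induction i) (simp_all add: diff_op_int_multiple)

text \<open>Taking \<open>m = p\<close> in the previous expansion, the translation is trivial because \<open>p y = 0\<close>, and the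
  binomial coefficients strictly between the ends are multiples of \<open>p\<close>, which kill \<open>p\<close>-torsion.
  What remains is \<open>P = P + (diff_op y)\<^sup>p P\<close>.\<close>

lemma diff_op_power_CARD_eq_0:
  fixes P :: "'p::prime_card mod_ring ^ 'n \<Rightarrow> circle"
  assumes "\<And>x. int CARD('p) *\<^sub>\<int> P x = 0"
  shows "(diff_op y ^^ CARD('p)) P = (\<lambda>x. 0)"
proof
  fix x
  let ?p = "CARD('p)"
  define a where "a i = (diff_op y ^^ i) P x" for i
  have p: "?p > 0" "prime ?p"
    using prime_card prime_gt_0_nat by blast+
  \<comment> \<open>Derivatives of a \<open>p\<close>-torsion function are again \<open>p\<close>-torsion.\<close>
  have tors: "int ?p *\<^sub>\<int> a i = 0" for i
    using fun_cong[OF diff_op_power_int_multiple[of i y "int ?p" P], of x] assms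
      foldr_diff_op_0[of "replicate i y"]
    by (simp add: a_def foldr_replicate)
  have mid: "int (?p choose i) *\<^sub>\<int> a i = 0" if "0 < i" "i < ?p" for i
  proof -
    have "?p dvd (?p choose i)"
      using that p by (intro dvd_choose_prime) auto
    then obtain j where "?p choose i = j * ?p"
      by (auto simp: dvd_def mult.commute)
    then show ?thesis
      using tors[of i] by (simp flip: int_multiple.scale_scale)
  qed
  have "P x = P (x + of_nat ?p *s y)"
    by simp
  also have "\<dots> = (\<Sum>i\<le>?p. int (?p choose i) *\<^sub>\<int> a i)"
    unfolding shift_eq_sum_diff_op a_def ..
  also have "\<dots> = (\<Sum>i\<in>{0, ?p}. int (?p choose i) *\<^sub>\<int> a i)"
    by (rule sum.mono_neutral_right) (use mid in auto)
  also have "\<dots> = P x + a ?p"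
    using p by (simp add: a_def)
  finally show "(diff_op y ^^ ?p) P x = 0"
    by (simp add: a_def)
qed

lemma foldr_diff_op_eq_0_if_count:
  fixes P :: "'p::prime_card mod_ring ^ 'n \<Rightarrow> circle"
  assumes "\<And>x. int CARD('p) *\<^sub>\<int> P x = 0" "CARD('p) \<le> count_list ys y"
  shows "foldr diff_op ys P = (\<lambda>x. 0)"
proof -
  let ?R = "replicate_mset CARD('p) y"
  have "?R \<subseteq># mset ys"
    using assms(2) by (simp add: count_le_replicate_mset_subset_eq[symmetric] count_mset)
  then obtain M where M: "mset ys = M + ?R"
    by (metis subset_mset.diff_add)
  obtain zs where "mset zs = M"
    using ex_mset by blast
  then have "mset ys = mset (zs @ replicate CARD('p) y)"
    using M by simp
  then have "foldr diff_op ys P = foldr diff_op zs ((diff_op y ^^ CARD('p)) P)"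
    by (simp add: foldr_diff_op_mset_eq[of ys "zs @ replicate CARD('p) y"] foldr_replicate)
  then show ?thesis
    using assms(1) by (simp add: diff_op_power_CARD_eq_0 foldr_diff_op_0)
qed

text \<open>Among more than \<open>|F\<^sup>n| (p - 1)\<close> directions, some direction occurs \<open>p\<close> times, so differencing along
  them kills every \<open>p\<close>-torsion function. Applied to \<open>p\<^sup>K P\<close>, this shows that one such block of
  derivatives lowers the exponent of torsion by one.\<close>

lemma foldr_diff_op_torsion:
  fixes P :: "'p::prime_card mod_ring ^ 'n::finite \<Rightarrow> circle"
  assumes "\<And>x. int CARD('p) ^ K *\<^sub>\<int> P x = 0"
    and "length ys \<ge> K * Suc (CARD('p mod_ring ^ 'n) * (CARD('p) - 1))"
  shows "foldr diff_op ys P = (\<lambda>x. 0)"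
  using assms
proof (induction K arbitrary: P ys)
  case 0
  then have "P = (\<lambda>x. 0)"
    by (simp add: fun_eq_iff)
  then show ?case
    by (simp add: foldr_diff_op_0)
next
  case (Suc K)
  let ?p = "CARD('p)" and ?N = "Suc (CARD('p mod_ring ^ 'n) * (CARD('p) - 1))"
  define us vs where "us = take (length ys - ?N) ys" and "vs = drop (length ys - ?N) ys"
  have ys: "ys = us @ vs"
    by (simp add: us_def vs_def)
  have len: "length vs = ?N" "length us \<ge> K * ?N"
    using Suc.prems(2) by (auto simp: us_def vs_def)
  have "\<exists>y. ?p \<le> count_list vs y"
  proof (rule ccontr)
    assume "\<nexists>y. ?p \<le> count_list vs y"
    then have "count_list vs y \<le> ?p - 1" for y
      by (metis Suc_pred' leI less_Suc_eq_le zero_less_card_finite)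
    then have "(\<Sum>y\<in>UNIV. count_list vs y) \<le> CARD('p mod_ring ^ 'n) * (?p - 1)"
      by (intro order.trans[OF sum_bounded_above]) auto
    then show False
      using len(1) by (simp add: sum_count_set)
  qed
  moreover have "int ?p *\<^sub>\<int> (int ?p ^ K *\<^sub>\<int> P x) = 0" for x
    using Suc.prems(1)[of x] by simp
  ultimately have "foldr diff_op vs (\<lambda>x. int ?p ^ K *\<^sub>\<int> P x) = (\<lambda>x. 0)"
    using foldr_diff_op_eq_0_if_count[of "\<lambda>x. int ?p ^ K *\<^sub>\<int> P x"] by blast
  then have "int ?p ^ K *\<^sub>\<int> foldr diff_op vs P x = 0" for x
    by (simp add: foldr_diff_op_int_multiple fun_eq_iff)
  then have "foldr diff_op us (foldr diff_op vs P) = (\<lambda>x. 0)"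
    using len(2) by (intro Suc.IH)
  then show ?case
    by (simp add: ys)
qed

lemma poly_deg_le_if_torsion:
  fixes P :: "'p::prime_card mod_ring ^ 'n::finite \<Rightarrow> circle"
  assumes "\<And>x. int CARD('p) ^ K *\<^sub>\<int> P x = 0"
  shows "\<exists>d. poly_deg_le d P"
  unfolding poly_deg_le_def using foldr_diff_op_torsion[of K P, OF assms]
  by (intro exI[of _ "K * Suc (CARD('p mod_ring ^ 'n) * (CARD('p) - 1))"]) simp

lemma additive_CARD_multiple_eq_0:
  fixes f :: "'p::prime_card mod_ring ^ 'n \<Rightarrow> circle"
  assumes "\<And>x y. f (x + y) = f x + f y"
  shows "int CARD('p) *\<^sub>\<int> f x = 0"
proof -
  have f0: "f 0 = 0"
    using assms[of 0 0] by simp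
  have "f (of_nat m *s x) = int m *\<^sub>\<int> f x" for m
    by (induction m) (simp_all add: f0 vector_sadd_rdistrib assms int_multiple.scale_left_distrib)
  from this[of "CARD('p)"] show ?thesis
    by (simp add: f0)
qed

text \<open>If all derivatives of \<open>P\<close> are killed by \<open>p\<^sup>d\<close> up to constants, then \<open>p\<^sup>d (P - P 0)\<close> has constant
  derivatives and vanishes at the origin. It is then additive, hence killed by \<open>p\<close>.\<close>

lemma torsion_if_poly_deg_le:
  fixes P :: "'p::prime_card mod_ring ^ 'n \<Rightarrow> circle"
  assumes "poly_deg_le d P"
  shows "int CARD('p) ^ d *\<^sub>\<int> (P x - P 0) = 0"
  using assms
proof (induction d arbitrary: P x)
  case 0
  then have "foldr diff_op [x] P 0 = 0"
    unfolding poly_deg_le_def by (metis length_Cons list.size(3) Suc_eq_plus1)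
  then show ?case
    by (simp add: diff_op_def)
next
  case (Suc d)
  let ?p = "int CARD('p)"
  have "poly_deg_le d (diff_op h P)" for h
    unfolding poly_deg_le_def
  proof (intro allI impI)
    fix ys :: "('p mod_ring ^ 'n) list" and x
    assume "length ys = d + 1"
    then have "foldr diff_op (ys @ [h]) P x = 0"
      using Suc.prems unfolding poly_deg_le_def by (metis Suc_eq_plus1 length_append_singleton)
    then show "foldr diff_op ys (diff_op h P) x = 0"
      by simp
  qed
  then have D: "?p ^ d *\<^sub>\<int> (diff_op h P x - diff_op h P 0) = 0" for h x
    by (rule Suc.IH)
  define f where "f x = ?p ^ d *\<^sub>\<int> (P x - P 0)" for x
  have "f (x + h) = f x + f h" for x h
    using D[of h x]
    by (simp add: f_def diff_op_def int_multiple.scale_right_diff_distrib algebra_simps)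
  then have "?p *\<^sub>\<int> f x = 0"
    by (rule additive_CARD_multiple_eq_0)
  then show ?case
    by (simp add: f_def)
qed

section \<open>Reduced monomials over the prime field\<close>

text \<open>Exponents between \<open>0\<close> and \<open>p - 1\<close> are represented by field elements, and exponent tuples by
  vectors over the field. Families of coefficients of monomials and functions on \<open>F\<^sup>n\<close> then have the
  same type, so that surjectivity of evaluation implies its injectivity without any counting.\<close>

definition residue :: "'p::prime_card mod_ring \<Rightarrow> nat" where
  "residue x = nat (to_int_mod_ring x)"

lemma to_int_mod_ring_range:
  "to_int_mod_ring (x :: 'p::prime_card mod_ring) \<in> {0..<int CARD('p)}"
  using range_to_int_mod_ring[where 'a = 'p] by blast

lemma of_int_to_int_mod_ring [simp]: "of_int (to_int_mod_ring x) = (x :: 'p::prime_card mod_ring)"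
  by (simp add: of_int_of_int_mod_ring)

lemma of_int_mod_ring_eq_iff:
  "(of_int a :: 'p::prime_card mod_ring) = of_int b \<longleftrightarrow> [a = b] (mod int CARD('p))"
  by (simp add: of_int_eq_iff_cong_CHAR)

lemma of_nat_residue [simp]: "of_nat (residue x) = (x :: 'p::prime_card mod_ring)"
proof -
  have "of_nat (residue x) = (of_int (to_int_mod_ring x) :: 'p mod_ring)"
    using to_int_mod_ring_range[of x] by (simp add: residue_def)
  then show ?thesis
    by simp
qed

lemma residue_less: "residue (x :: 'p::prime_card mod_ring) < CARD('p)"
  using to_int_mod_ring_range[of x] by (simp add: residue_def nat_less_iff)

lemma residue_0 [simp]: "residue (0 :: 'p::prime_card mod_ring) = 0"
  by (simp add: residue_def)

lemma residue_of_nat: "m < CARD('p) \<Longrightarrow> residue (of_nat m :: 'p::prime_card mod_ring) = m"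
  by (simp add: residue_def of_nat_of_int_mod_ring)

lemma residue_eq_0_iff: "residue (x :: 'p::prime_card mod_ring) = 0 \<longleftrightarrow> x = 0"
  by (metis of_nat_0 of_nat_residue residue_0)

lemma bij_betw_residue: "bij_betw residue (UNIV :: 'p::prime_card mod_ring set) {..<CARD('p)}"
  by (rule bij_betw_byWitness[where f' = of_nat]) (auto simp: residue_less residue_of_nat)

lemma mod_ring_power_CARD: "(x :: 'p::prime_card mod_ring) ^ CARD('p) = x"
  using finite_field_power_card_eq_same[of x] by simp

lemma mod_ring_power_CARD_power: "(x :: 'p::prime_card mod_ring) ^ CARD('p) ^ k = x"
  by (induction k) (simp_all add: power_mult mod_ring_power_CARD)

text \<open>By the little Fermat theorem the indicator of the point \<open>a\<close> is \<open>1 - (t - a)\<^sup>p\<^sup>-\<^sup>1\<close>, which the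
  binomial theorem expands into powers of \<open>t\<close>.\<close>

lemma point_indicator_interpolation:
  "\<exists>m :: 'p mod_ring \<Rightarrow> 'p mod_ring. \<forall>t :: 'p::prime_card mod_ring. (if t = a then 1 else 0) = (\<Sum>e\<in>UNIV. m e * t ^ residue e)"
proof -
  define q where "q = CARD('p) - 1"
  have q: "CARD('p) = Suc q" "q > 0"
    using prime_gt_1_nat[OF prime_card[where 'a = 'p]] by (auto simp: q_def)
  define m where "m e = (if e = 0 then 1 else 0) - of_nat (q choose residue e) * (- a) ^ (q - residue e)"
    for e :: "'p mod_ring"
  have "(if t = a then 1 else 0) = (\<Sum>e\<in>UNIV. m e * t ^ residue e)" for t
  proof -
    have "(\<Sum>e\<in>(UNIV :: 'p mod_ring set). of_nat (q choose residue e) * (- a) ^ (q - residue e) * t ^ residue e)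
        = (\<Sum>j<CARD('p). of_nat (q choose j) * (- a) ^ (q - j) * t ^ j)"
      by (rule sum.reindex_bij_betw[OF bij_betw_residue,
            of "\<lambda>j. of_nat (q choose j) * (- a) ^ (q - j) * t ^ j"])
    also have "\<dots> = (t - a) ^ q"
      using binomial_ring[of t "- a" q] q(1) by (simp add: lessThan_Suc_atMost mult_ac)
    also have "\<dots> = (if t = a then 0 else 1)"
    proof (cases "t = a")
      case False
      have "(t - a) * (t - a) ^ q = t - a"
        using mod_ring_power_CARD[of "t - a"] q(1) by simp
      then show ?thesis
        using False by simp
    qed (use q in simp)
    finally have "(\<Sum>e\<in>(UNIV :: 'p mod_ring set). of_nat (q choose residue e) * (- a) ^ (q - residue e) * t ^ residue e)
        = (if t = a then 0 else 1)" .
    moreover have "(\<Sum>e\<in>UNIV. (if e = 0 then 1 else 0) * t ^ residue (e :: 'p mod_ring)) = 1"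
      by (simp add: if_distrib[of "\<lambda>z. z * _"] sum.delta cong: if_cong)
    ultimately show ?thesis
      by (simp add: m_def left_diff_distrib sum_subtractf)
  qed
  then show ?thesis
    by blast
qed

definition monomial :: "'p::prime_card mod_ring ^ 'n::finite \<Rightarrow> 'p mod_ring ^ 'n \<Rightarrow> 'p mod_ring" where
  "monomial v x = (\<Prod>i\<in>UNIV. (x $ i) ^ residue (v $ i))"

lemma bij_vec_lambda: "bij (vec_lambda :: ('n \<Rightarrow> 'a) \<Rightarrow> 'a ^ 'n)"
  by (rule bij_betw_byWitness[where f' = vec_nth]) auto

text \<open>Indicators of points of \<open>F\<^sup>n\<close> are products of the one-variable indicators; multiplying out
  gives combinations of monomials, and every function is a combination of indicators.\<close>

lemma monomials_span:
  fixes f :: "'p::prime_card mod_ring ^ 'n::finite \<Rightarrow> 'p mod_ring"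
  shows "\<exists>c. \<forall>x. f x = (\<Sum>v\<in>UNIV. c v * monomial v x)"
proof -
  obtain m :: "'p mod_ring \<Rightarrow> 'p mod_ring \<Rightarrow> 'p mod_ring" where
    m: "\<And>a t :: 'p mod_ring. (if t = a then 1 else 0) = (\<Sum>e\<in>UNIV. m a e * t ^ residue e)"
    using point_indicator_interpolation by metis
  define M where "M a v = (\<Prod>i\<in>UNIV. m (a $ i) (v $ i))" for a v :: "'p mod_ring ^ 'n"
  have ind: "(if x = a then 1 else 0) = (\<Sum>v\<in>UNIV. M a v * monomial v x)" for a x :: "'p mod_ring ^ 'n"
  proof -
    have "(if x = a then 1 else 0) = (\<Prod>i\<in>UNIV. if x $ i = a $ i then 1 else 0 :: 'p mod_ring)"
      by (auto simp: vec_eq_iff)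
    also have "\<dots> = (\<Prod>i\<in>UNIV. \<Sum>e\<in>UNIV. m (a $ i) e * (x $ i) ^ residue e)"
      by (simp only: m)
    also have "\<dots> = (\<Sum>g\<in>UNIV. \<Prod>i\<in>UNIV. m (a $ i) (g i) * (x $ i) ^ residue (g i))"
      by (simp add: prod_sum_PiE PiE_UNIV_domain)
    also have "\<dots> = (\<Sum>g\<in>UNIV. M a (vec_lambda g) * monomial (vec_lambda g) x)"
      by (simp add: M_def monomial_def prod.distrib)
    also have "\<dots> = (\<Sum>v\<in>UNIV. M a v * monomial v x)"
      by (rule sum.reindex_bij_betw[OF bij_vec_lambda])
    finally show ?thesis .
  qed
  have "f x = (\<Sum>v\<in>UNIV. (\<Sum>a\<in>UNIV. f a * M a v) * monomial v x)" for x
  proof -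
    have "f x = (\<Sum>a\<in>UNIV. f a * (if x = a then 1 else 0))"
      by (simp add: if_distrib[of "\<lambda>z. f _ * z"] cong: if_cong)
    also have "\<dots> = (\<Sum>a\<in>UNIV. \<Sum>v\<in>UNIV. f a * M a v * monomial v x)"
      by (simp only: ind sum_distrib_left mult.assoc)
    also have "\<dots> = (\<Sum>v\<in>UNIV. \<Sum>a\<in>UNIV. f a * M a v * monomial v x)"
      by (rule sum.swap)
    finally show ?thesis
      by (simp add: sum_distrib_right)
  qed
  then show ?thesis
    by (intro exI[of _ "\<lambda>v. \<Sum>a\<in>UNIV. f a * M a v"] allI)
qed

text \<open>Evaluation maps the finite set of coefficient families onto the set of functions, by
  the spanning property. Source and target have the same type, so evaluation is injective.\<close>

lemma monomials_independent:
  fixes c :: "'p::prime_card mod_ring ^ 'n::finite \<Rightarrow> 'p mod_ring"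
  assumes "\<And>x. (\<Sum>v\<in>UNIV. c v * monomial v x) = 0"
  shows "c v = 0"
proof -
  define E where "E = (\<lambda>(c :: 'p mod_ring ^ 'n \<Rightarrow> 'p mod_ring) x. \<Sum>v\<in>UNIV. c v * monomial v x)"
  have "\<exists>c. f = E c" for f
    using monomials_span[of f] unfolding E_def by auto
  then have "surj E"
    by (auto simp: surj_def)
  then have "inj E"
    by (rule finite_UNIV_surj_inj[rotated]) simp
  then have "E c = E (\<lambda>v. 0) \<longleftrightarrow> c = (\<lambda>v. 0)"
    by (rule inj_eq)
  moreover have "E c = E (\<lambda>v. 0)"
    using assms by (simp add: E_def)
  ultimately have "c = (\<lambda>v. 0)"
    by blast
  then show ?thesis
    by simp
qed

definition int_monomial :: "'p::prime_card mod_ring ^ 'n::finite \<Rightarrow> 'p mod_ring ^ 'n \<Rightarrow> int" where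
  "int_monomial v x = (\<Prod>i\<in>UNIV. to_int_mod_ring (x $ i) ^ residue (v $ i))"

lemma of_int_int_monomial: "of_int (int_monomial v x) = monomial v x"
  by (simp add: int_monomial_def monomial_def)

lemma int_monomial_0:
  assumes "v \<noteq> 0"
  shows "int_monomial v 0 = 0"
proof -
  obtain i where "v $ i \<noteq> 0"
    using assms by (auto simp: vec_eq_iff)
  then have "to_int_mod_ring ((0 :: 'a mod_ring ^ 'b) $ i) ^ residue (v $ i) = 0"
    by (simp add: power_0_left residue_eq_0_iff)
  then show ?thesis
    unfolding int_monomial_def by (intro prod_zero) auto
qed

lemma monomial_0: "v \<noteq> 0 \<Longrightarrow> monomial v 0 = 0" "monomial 0 x = 1"
  by (simp_all flip: of_int_int_monomial add: int_monomial_0) (simp add: int_monomial_def)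

section \<open>Digit expansions\<close>

text \<open>The single property on which digit expansions rest: \<open>p\<^sup>k\<close> times the \<open>k\<close>-th function attached
  to \<open>v\<close> is the classical monomial \<open>x\<^sup>v / p\<close>. It holds both for the monomials \<open>|x|\<^sup>v / p\<^sup>k\<^sup>+\<^sup>1\<close> of the
  structure theorem and for the homogeneous lifts constructed later, so one argument serves both.\<close>

definition monomial_lift ::
    "('p::prime_card mod_ring ^ 'n::finite \<Rightarrow> nat \<Rightarrow> 'p mod_ring ^ 'n \<Rightarrow> circle) \<Rightarrow> bool" where
  "monomial_lift g \<longleftrightarrow> (\<forall>v k. v \<noteq> 0 \<longrightarrow> g v k 0 = 0 \<and>
     (\<forall>x. int CARD('p) ^ k *\<^sub>\<int> g v k x = circle_frac (int_monomial v x) (int CARD('p))))"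

text \<open>The function \<open>p\<^sup>K P\<close> takes values in multiples of \<open>1/p\<close>, so it is a function into the field, and
  its monomial coefficients are the digits at level \<open>K\<close>. Subtracting this layer leaves a function
  killed by \<open>p\<^sup>K\<close>. The zero exponent never contributes because all functions involved vanish
  at the origin.\<close>

lemma digit_expansion_exists:
  fixes P :: "'p::prime_card mod_ring ^ 'n::finite \<Rightarrow> circle"
  assumes g: "monomial_lift g"
    and "\<And>x. int CARD('p) ^ K *\<^sub>\<int> P x = 0" "P 0 = 0"
  shows "\<exists>c. (\<forall>v k. c v k \<in> {0..<int CARD('p)}) \<and>
    (\<forall>x. P x = (\<Sum>k<K. \<Sum>v\<in>- {0}. c v k *\<^sub>\<int> g v k x))"
  using assms(2,3)
proof (induction K arbitrary: P)
  case 0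
  then show ?case
    by (intro exI[of _ "\<lambda>_ _. 0"]) auto
next
  case (Suc K)
  let ?p = "int CARD('p)"
  have "\<exists>m. ?p ^ K *\<^sub>\<int> P x = circle_frac m ?p" for x
    using Suc.prems(1)[of x] by (intro torsion_imp_circle_frac) simp_all
  then obtain m where m: "\<And>x. ?p ^ K *\<^sub>\<int> P x = circle_frac (m x) ?p"
    by metis
  obtain a where a: "\<And>x. of_int (m x) = (\<Sum>v\<in>UNIV. a v * monomial v x)"
    using monomials_span[of "\<lambda>x. of_int (m x)"] by blast
  have split: "(\<Sum>v\<in>UNIV. a v * monomial v x) = a 0 + (\<Sum>v\<in>- {0}. a v * monomial v x)" for x
    by (simp add: sum.remove[of UNIV 0] monomial_0 Compl_eq_Diff_UNIV)
  have "circle_frac (m 0) ?p = circle_frac 0 ?p"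
    using m[of 0] Suc.prems(2) by (simp add: circle_frac_0)
  then have "(of_int (m 0) :: 'p mod_ring) = of_int 0"
    unfolding of_int_mod_ring_eq_iff by (simp add: circle_frac_eq_iff)
  \<comment> \<open>At the origin every monomial except the constant one vanishes.\<close>
  then have a0: "a 0 = 0"
    using a[of 0] split[of 0] by (simp add: monomial_0)
  define b where "b v = to_int_mod_ring (a v)" for v
  have "of_int (m x) = (of_int (\<Sum>v\<in>- {0}. b v * int_monomial v x) :: 'p mod_ring)" for x
    using a[of x] split[of x] a0 by (simp add: b_def of_int_int_monomial)
  then have "circle_frac (m x) ?p = circle_frac (\<Sum>v\<in>- {0}. b v * int_monomial v x) ?p" for x
    by (simp add: circle_frac_eq_iff of_int_mod_ring_eq_iff del: of_int_sum)
  then have top: "?p ^ K *\<^sub>\<int> P x = (\<Sum>v\<in>- {0}. b v *\<^sub>\<int> circle_frac (int_monomial v x) ?p)" for x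
    by (simp add: m circle_frac_sum int_multiple_circle_frac)
  define Q where "Q x = P x - (\<Sum>v\<in>- {0}. b v *\<^sub>\<int> g v K x)" for x
  have "?p ^ K *\<^sub>\<int> Q x = 0" for x
  proof -
    have "?p ^ K *\<^sub>\<int> (b v *\<^sub>\<int> g v K x) = b v *\<^sub>\<int> circle_frac (int_monomial v x) ?p" if "v \<noteq> 0" for v
      using g that unfolding monomial_lift_def by (metis int_multiple.scale_left_commute)
    then show ?thesis
      by (simp add: Q_def int_multiple.scale_right_diff_distrib int_multiple.scale_sum_right top)
  qed
  moreover have "Q 0 = 0"
    using g Suc.prems(2) by (simp add: Q_def monomial_lift_def)
  ultimately obtain c where c: "\<And>v k. c v k \<in> {0..<?p}"
    "\<And>x. Q x = (\<Sum>k<K. \<Sum>v\<in>- {0}. c v k *\<^sub>\<int> g v k x)"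
    using Suc.IH[of Q] by blast
  define c' where "c' v k = (if k = K then b v else c v k)" for v k
  have "P x = (\<Sum>k<Suc K. \<Sum>v\<in>- {0}. c' v k *\<^sub>\<int> g v k x)" for x
    using c(2)[of x] by (simp add: c'_def Q_def algebra_simps)
  moreover have "c' v k \<in> {0..<?p}" for v k
    unfolding c'_def b_def using c(1) to_int_mod_ring_range by auto
  ultimately show ?case
    by blast
qed

lemma monomial_lift_torsion:
  fixes g :: "'p::prime_card mod_ring ^ 'n::finite \<Rightarrow> nat \<Rightarrow> 'p mod_ring ^ 'n \<Rightarrow> circle"
  assumes "monomial_lift g" "v \<noteq> 0" "k < K"
  shows "int CARD('p) ^ K *\<^sub>\<int> g v k x = 0"
proof -
  let ?p = "int CARD('p)"
  obtain j where j: "K = Suc (j + k)"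
    using assms(3) less_iff_Suc_add by (metis add.commute)
  have "?p ^ K *\<^sub>\<int> g v k x = (?p ^ j * ?p) *\<^sub>\<int> (?p ^ k *\<^sub>\<int> g v k x)"
    by (simp add: j power_add mult_ac)
  also have "\<dots> = ?p ^ j *\<^sub>\<int> circle_frac (?p * int_monomial v x) ?p"
    using assms by (simp add: monomial_lift_def int_multiple_circle_frac mult_ac)
  also have "circle_frac (?p * int_monomial v x) ?p = circle_frac 0 ?p"
    by (simp add: circle_frac_eq_iff cong_def)
  finally show ?thesis
    by (simp add: circle_frac_0)
qed

text \<open>Multiplication by \<open>p\<^sup>K\<close> isolates the top layer of a relation, which is a relation between
  classical monomials; independence makes the top coefficients multiples of \<open>p\<close>. Coefficients
  are allowed to be negative since the lemma is applied to differences of digits.\<close>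

lemma digit_expansion_unique:
  fixes g :: "'p::prime_card mod_ring ^ 'n::finite \<Rightarrow> nat \<Rightarrow> 'p mod_ring ^ 'n \<Rightarrow> circle"
  assumes g: "monomial_lift g"
    and d: "\<And>v k. \<bar>d v k\<bar> < int CARD('p)"
    and "\<And>x. (\<Sum>k<K. \<Sum>v\<in>- {0}. d v k *\<^sub>\<int> g v k x) = 0" "k < K" "v \<noteq> 0"
  shows "d v k = 0"
  using assms(3-)
proof (induction K arbitrary: k v)
  case (Suc K)
  let ?p = "int CARD('p)"
  have top: "d v K = 0" if "v \<noteq> 0" for v
  proof -
    have "[(\<Sum>v\<in>- {0}. d v K * int_monomial v x) = 0] (mod ?p)" for x
    proof -
      have "?p ^ K *\<^sub>\<int> (d v k *\<^sub>\<int> g v k x) = 0" if "v \<noteq> 0" "k < K" for v k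
        using monomial_lift_torsion[OF g that] by (metis int_multiple.scale_left_commute int_multiple.scale_zero_right)
      moreover have "?p ^ K *\<^sub>\<int> (d v K *\<^sub>\<int> g v K x) = circle_frac (d v K * int_monomial v x) ?p" if "v \<noteq> 0" for v
        using g that unfolding monomial_lift_def
        by (metis int_multiple.scale_left_commute int_multiple_circle_frac)
      ultimately have "?p ^ K *\<^sub>\<int> (\<Sum>k<Suc K. \<Sum>v\<in>- {0}. d v k *\<^sub>\<int> g v k x)
          = circle_frac (\<Sum>v\<in>- {0}. d v K * int_monomial v x) ?p"
        by (simp add: int_multiple.scale_right_distrib int_multiple.scale_sum_right circle_frac_sum)
      then have "circle_frac (\<Sum>v\<in>- {0}. d v K * int_monomial v x) ?p = circle_frac 0 ?p"
        unfolding Suc.prems(1) by (simp add: circle_frac_0)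
      then show ?thesis
        by (simp add: circle_frac_eq_iff)
    qed
    then have zero: "(\<Sum>v\<in>- {0}. of_int (d v K) * monomial v x) = (0 :: 'p mod_ring)" for x
      using of_int_mod_ring_eq_iff[of "\<Sum>v\<in>- {0}. d v K * int_monomial v x" 0, where 'p = 'p]
      by (simp add: of_int_int_monomial)
    have "(\<Sum>v\<in>UNIV. (if v = 0 then 0 else of_int (d v K)) * monomial v x) = (0 :: 'p mod_ring)" for x
    proof -
      have "(\<Sum>v\<in>UNIV. (if v = 0 then 0 else of_int (d v K)) * monomial v x)
          = (\<Sum>v\<in>- {0}. of_int (d v K) * monomial v x :: 'p mod_ring)"
        by (rule sum.mono_neutral_cong_right) auto
      then show ?thesis
        using zero by simp
    qed
    then have "(if v = 0 then 0 else of_int (d v K)) = (0 :: 'p mod_ring)"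
      by (rule monomials_independent)
    then have "[d v K = 0] (mod ?p)"
      using that of_int_mod_ring_eq_iff[of "d v K" 0, where 'p = 'p] by simp
    then have "?p dvd d v K"
      by (simp add: cong_0_iff)
    then show "d v K = 0"
      using d[of v K] by (metis dvd_imp_le_int not_le abs_of_nat)
  qed
  show ?case
  proof (cases "k = K")
    case False
    have "(\<Sum>k<K. \<Sum>v\<in>- {0}. d v k *\<^sub>\<int> g v k x) = 0" for x
      using Suc.prems(1)[of x] by (simp add: top)
    then show ?thesis
      using Suc.IH Suc.prems False by simp
  qed (use top Suc.prems in simp)
qed simp

section \<open>Shift-zero polynomials as torsion functions\<close>

lemma monomial_lift_standard:
  "monomial_lift (\<lambda>(v :: 'p::prime_card mod_ring ^ 'n::finite) k x.
    circle_frac (int_monomial v x) (int CARD('p) ^ (k + 1)))"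
proof -
  have "int CARD('p) ^ k *\<^sub>\<int> circle_frac a (int CARD('p) ^ (k + 1)) = circle_frac a (int CARD('p))" for a k
  proof -
    have "int CARD('p) ^ k *\<^sub>\<int> circle_frac a (int CARD('p) ^ (k + 1))
        = circle_frac (int CARD('p) ^ k * a) (int CARD('p) ^ k * int CARD('p))"
      by (simp add: int_multiple_circle_frac mult.commute)
    then show ?thesis
      by (simp add: circle_frac_cancel)
  qed
  then show ?thesis
    by (simp add: monomial_lift_def int_monomial_0 circle_frac_0)
qed

lemma finite_exponents:
  assumes "p > 1"
  shows "finite (exponents p d :: (('n::finite \<Rightarrow> nat) \<times> nat) set)"
proof (rule finite_subset)
  show "exponents p d \<subseteq> (PiE UNIV (\<lambda>_ :: 'n. {..<p})) \<times> {..d}"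
  proof
    fix z :: "('n \<Rightarrow> nat) \<times> nat"
    assume "z \<in> exponents p d"
    moreover obtain e k where z: "z = (e, k)"
      by fastforce
    ultimately have "\<forall>i. e i < p" "k * (p - 1) \<le> d"
      by (auto simp: exponents_def)
    moreover have "k \<le> k * (p - 1)"
      using assms by (cases p) auto
    ultimately have "\<forall>i. e i < p" "k \<le> d"
      by (blast intro: order.trans)+
    then show "z \<in> (PiE UNIV (\<lambda>_ :: 'n. {..<p})) \<times> {..d}"
      by (auto simp: z PiE_UNIV_domain)
  qed
qed (simp add: finite_PiE)

text \<open>Digit expansions indexed by vectors and levels below \<open>K\<close> are expansions of the Tao--Ziegler
  form: exponents are reindexed, and the degree bound is chosen large enough to admit every
  exponent tuple at each of the \<open>K\<close> levels.\<close>

lemma digit_expansion_eq_expansion: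
  fixes c :: "'p::prime_card mod_ring ^ 'n::finite \<Rightarrow> nat \<Rightarrow> int"
  assumes c: "\<And>v k. c v k \<in> {0..<int CARD('p)}"
  shows "\<exists>d c'. (\<forall>e k. c' e k \<in> {0..<CARD('p)}) \<and>
    (\<forall>x. (\<Sum>k<K. \<Sum>v\<in>- {0}. c v k *\<^sub>\<int> circle_frac (int_monomial v x) (int CARD('p) ^ (k + 1)))
      = mod1 (expansion d c' x))"
proof -
  let ?p = "CARD('p)"
  have p: "?p > 1"
    using prime_gt_1_nat[OF prime_card] .
  define d where "d = CARD('n) * (?p - 1) + K * (?p - 1)"
  define c' where "c' e k = (if k < K \<and> (\<forall>i. e i < ?p) then nat (c (\<chi> i. of_nat (e i)) k) else 0)"
    for e :: "'n \<Rightarrow> nat" and k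
  define \<phi> where "\<phi> = (\<lambda>(k :: nat, v :: 'p mod_ring ^ 'n). (\<lambda>i. residue (v $ i), k))"
  have vec: "(\<chi> i. of_nat (residue (v $ i))) = v" for v :: "'p mod_ring ^ 'n"
    by (simp add: vec_eq_iff)
  have digit: "c' (\<lambda>i. residue (v $ i)) k = nat (c v k)" if "k < K" for v k
    using that by (simp add: c'_def residue_less vec)
  have inj: "inj_on \<phi> A" for A
    by (rule inj_on_inverseI[where g = "\<lambda>(e, k). (k, \<chi> i. of_nat (e i))"]) (auto simp: \<phi>_def vec)
  have sub: "\<phi> ` ({..<K} \<times> - {0}) \<subseteq> exponents ?p d"
  proof
    fix z
    assume "z \<in> \<phi> ` ({..<K} \<times> - {0})"
    then obtain k v where "z = \<phi> (k, v)" and "k < K" "v \<noteq> 0"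
      by blast
    then have z: "z = (\<lambda>i. residue (v $ i), k)"
      by (simp add: \<phi>_def)
    from \<open>v \<noteq> 0\<close> obtain i where "v $ i \<noteq> 0"
      by (auto simp: vec_eq_iff)
    then have "0 < residue (v $ i)"
      using residue_eq_0_iff neq0_conv by blast
    then have "0 < (\<Sum>i\<in>UNIV. residue (v $ i))"
      by (intro sum_pos2[of _ i]) auto
    moreover have "residue (v $ i) \<le> ?p - 1" for i
      using residue_less[of "v $ i"] by simp
    then have "(\<Sum>i\<in>UNIV. residue (v $ i)) \<le> CARD('n) * (?p - 1)"
      by (intro order.trans[OF sum_bounded_above]) auto
    moreover have "k * (?p - 1) \<le> K * (?p - 1)"
      using \<open>k < K\<close> by simp
    ultimately show "z \<in> exponents ?p d"
      unfolding z exponents_def d_def using residue_less by (blast intro: add_mono)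
  qed
  have "mod1 (expansion d c' x)
      = (\<Sum>k<K. \<Sum>v\<in>- {0}. c v k *\<^sub>\<int> circle_frac (int_monomial v x) (int ?p ^ (k + 1)))" for x
  proof -
    define F where "F = (\<lambda>(e, k). real (c' e k) *
      (\<Prod>i\<in>UNIV. real_of_int (to_int_mod_ring (x $ i)) ^ e i) / real ?p ^ (k + 1))"
    have F\<phi>: "F (\<phi> (k, v)) = of_int (c v k) * (of_int (int_monomial v x) / real ?p ^ (k + 1))" if "k < K" for k v
    proof -
      have "real (c' (\<lambda>i. residue (v $ i)) k) = of_int (c v k)"
        using c[of v k] unfolding digit[OF that] by simp
      then show ?thesis
        by (simp add: F_def \<phi>_def int_monomial_def)
    qed
    \<comment> \<open>Terms at levels \<open>k < K\<close> all come from nonzero vectors; at higher levels the coefficients are zero.\<close>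
    have zero: "F (e, k) = 0" if "(e, k) \<in> exponents ?p d - \<phi> ` ({..<K} \<times> - {0})" for e k
    proof -
      have "\<not> k < K"
      proof
        assume "k < K"
        define v :: "'p mod_ring ^ 'n" where "v = (\<chi> i. of_nat (e i))"
        have e: "(\<lambda>i. residue (v $ i)) = e"
          using that by (auto simp: v_def residue_of_nat exponents_def)
        moreover have "v \<noteq> 0"
        proof
          assume "v = 0"
          then have "e = (\<lambda>i. 0)"
            using e by (simp add: fun_eq_iff)
          then show False
            using that by (simp add: exponents_def)
        qed
        ultimately have "(e, k) \<in> \<phi> ` ({..<K} \<times> - {0})"
          using \<open>k < K\<close> by (intro image_eqI[of _ _ "(k, v)"]) (auto simp: \<phi>_def)
        then show False
          using that by blast
      qed
      then show ?thesis
        by (simp add: F_def c'_def)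
    qed
    have "expansion d c' x = (\<Sum>z\<in>exponents ?p d. F z)"
      by (simp add: expansion_def F_def)
    also have "\<dots> = (\<Sum>z\<in>\<phi> ` ({..<K} \<times> - {0}). F z)"
    proof (rule sum.mono_neutral_right[OF finite_exponents[OF p] sub])
      show "\<forall>z\<in>exponents ?p d - \<phi> ` ({..<K} \<times> - {0}). F z = 0"
        using zero by (metis surj_pair)
    qed
    also have "\<dots> = (\<Sum>(k, v)\<in>{..<K} \<times> - {0}. F (\<phi> (k, v)))"
      by (simp add: sum.reindex[OF inj] case_prod_unfold)
    also have "\<dots> = (\<Sum>k<K. \<Sum>v\<in>- {0}. of_int (c v k) * (of_int (int_monomial v x) / real ?p ^ (k + 1)))"
      by (subst sum.cartesian_product[symmetric]) (simp add: F\<phi>)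
    also have "mod1 \<dots> = (\<Sum>k<K. \<Sum>v\<in>- {0}. c v k *\<^sub>\<int> circle_frac (int_monomial v x) (int ?p ^ (k + 1)))"
      by (simp only: mod1_sum circle_frac_def int_multiple_mod1 of_int_power of_int_of_nat_eq)
    finally show ?thesis .
  qed
  moreover have "\<forall>e k. c' e k \<in> {0..<?p}"
    using c p by (auto simp: c'_def nat_less_iff)
  ultimately show ?thesis
    by (intro exI[of _ d] exI[of _ c']) simp
qed

text \<open>The definite description in the shift needs an actual expansion. For torsion functions the
  digit expansion in the standard monomials provides one with constant term \<open>P 0\<close>.\<close>

lemma poly_shift_torsion:
  fixes P :: "'p::prime_card mod_ring ^ 'n::finite \<Rightarrow> circle"
  assumes "\<And>x. int CARD('p) ^ K *\<^sub>\<int> (P x - P 0) = 0"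
  shows "poly_shift P = P 0"
proof -
  define Q where "Q x = P x - P 0" for x
  have "\<And>x. int CARD('p) ^ K *\<^sub>\<int> Q x = 0" "Q 0 = 0"
    using assms by (simp_all only: Q_def diff_self)
  from digit_expansion_exists[where P = Q and K = K, OF monomial_lift_standard this] obtain c where
    c: "\<And>v k. c v k \<in> {0..<int CARD('p)}"
    and Q: "\<And>x. Q x = (\<Sum>k<K. \<Sum>v\<in>- {0}. c v k *\<^sub>\<int> circle_frac (int_monomial v x) (int CARD('p) ^ (k + 1)))"
    by blast
  from digit_expansion_eq_expansion[where c = c and K = K, OF c] obtain d c' where
    c': "\<forall>e k. c' e k \<in> {0..<CARD('p)}" and "\<forall>x. Q x = mod1 (expansion d c' x)"
    unfolding Q by blast
  then have "\<forall>x. P x = P 0 + mod1 (expansion d c' x)"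
    by (metis Q_def add.commute diff_add_cancel)
  then show ?thesis
    by (rule poly_shift_eqI[OF c'])
qed

text \<open>This reduces the theorem to the group of all functions of bounded \<open>p\<close>-power torsion vanishing at
  the origin, where polynomials can be taken apart one power of \<open>p\<close> at a time.\<close>

lemma nc_Poly_iff:
  fixes P :: "'p::prime_card mod_ring ^ 'n::finite \<Rightarrow> circle"
  shows "P \<in> nc_Poly \<longleftrightarrow> P 0 = 0 \<and> (\<exists>K. \<forall>x. int CARD('p) ^ K *\<^sub>\<int> P x = 0)"
proof
  assume "P \<in> nc_Poly"
  then obtain d where "poly_deg_le d P" and shift: "poly_shift P = 0"
    by (auto simp: nc_Poly_def)
  then have tors: "int CARD('p) ^ d *\<^sub>\<int> (P x - P 0) = 0" for x
    by (intro torsion_if_poly_deg_le)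
  then have "P 0 = 0"
    using poly_shift_torsion[of d P] shift by simp
  then show "P 0 = 0 \<and> (\<exists>K. \<forall>x. int CARD('p) ^ K *\<^sub>\<int> P x = 0)"
    using tors by auto
next
  assume "P 0 = 0 \<and> (\<exists>K. \<forall>x. int CARD('p) ^ K *\<^sub>\<int> P x = 0)"
  then show "P \<in> nc_Poly"
    using poly_deg_le_if_torsion[of _ P] poly_shift_torsion[of _ P] by (auto simp: nc_Poly_def)
qed

section \<open>Homogeneous lifts of monomials\<close>

text \<open>In \<open>a\<^sup>p - b\<^sup>p = (a - b) (a\<^sup>p\<^sup>-\<^sup>1 + \<dots> + b\<^sup>p\<^sup>-\<^sup>1)\<close> the second factor is a sum of \<open>p\<close> terms that are congruent
  modulo \<open>p\<close>, so it supplies one more factor \<open>p\<close>.\<close>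

lemma cong_power_lift:
  fixes a b :: int
  assumes "[a = b] (mod int p ^ Suc j)"
  shows "[a ^ p = b ^ p] (mod int p ^ Suc (Suc j))"
proof (cases p)
  case 0
  then show ?thesis
    by simp
next
  case (Suc n)
  have ab: "[a = b] (mod int p)"
    by (rule cong_dvd_modulus[OF assms]) simp
  have "[(\<Sum>i<Suc n. a ^ i * b ^ (n - i)) = (\<Sum>i<Suc n. b ^ i * b ^ (n - i))] (mod int p)"
    by (intro cong_sum cong_mult cong_pow ab cong_refl)
  also have "(\<Sum>i<Suc n. b ^ i * b ^ (n - i)) = (\<Sum>i<Suc n. b ^ n)"
    by (rule sum.cong) (simp_all flip: power_add)
  also have "\<dots> = int p * b ^ n"
    by (simp add: Suc)
  also have "[\<dots> = 0] (mod int p)"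
    by (simp add: cong_0_iff)
  finally have "int p dvd (\<Sum>i<Suc n. a ^ i * b ^ (n - i))"
    by (simp only: cong_0_iff)
  moreover have "int p ^ Suc j dvd a - b"
    using assms by (simp add: cong_iff_dvd_diff)
  ultimately have "int p ^ Suc j * int p dvd (a - b) * (\<Sum>i<Suc n. a ^ i * b ^ (n - i))"
    by (rule mult_dvd_mono[rotated])
  also have "(a - b) * (\<Sum>i<Suc n. a ^ i * b ^ (n - i)) = a ^ p - b ^ p"
    unfolding Suc diff_power_eq_sum ..
  finally show ?thesis
    by (simp add: cong_iff_dvd_diff mult_ac)
qed

lemma cong_power_lift_iterated:
  fixes a b :: int
  assumes "[a = b] (mod int p)"
  shows "[a ^ p ^ k = b ^ p ^ k] (mod int p ^ (k + 1))"
proof (induction k)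
  case (Suc k)
  then have "[(a ^ p ^ k) ^ p = (b ^ p ^ k) ^ p] (mod int p ^ Suc (Suc k))"
    by (intro cong_power_lift) simp
  moreover have "(z ^ p ^ k) ^ p = z ^ p ^ Suc k" for z :: int
    by (simp only: power_mult power_Suc2)
  ultimately show ?case
    by simp
qed (use assms in simp)

text \<open>Modulo \<open>p\<^sup>k\<^sup>+\<^sup>1\<close>, the power \<open>a ^ p ^ k\<close> depends only on the residue of \<open>a\<close> modulo \<open>p\<close> and is its
  Teichmueller representative. Using it in place of \<open>a\<close> makes the lift of a monomial to
  denominator \<open>p\<^sup>k\<^sup>+\<^sup>1\<close> multiplicative in \<open>x\<close>.\<close>

definition teichmuller_monomial ::
    "'p::prime_card mod_ring ^ 'n::finite \<Rightarrow> nat \<Rightarrow> 'p mod_ring ^ 'n \<Rightarrow> circle" where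
  "teichmuller_monomial v k x = circle_frac (int_monomial v x ^ CARD('p) ^ k) (int CARD('p) ^ (k + 1))"

lemma monomial_lift_teichmuller:
  "monomial_lift (teichmuller_monomial :: 'p::prime_card mod_ring ^ 'n::finite \<Rightarrow> _)"
  unfolding monomial_lift_def
proof (intro allI impI conjI)
  fix v x :: "'p mod_ring ^ 'n" and k
  let ?p = "int CARD('p)"
  assume "v \<noteq> 0"
  then show "teichmuller_monomial v k 0 = 0"
    by (simp add: teichmuller_monomial_def int_monomial_0 circle_frac_0 power_0_left)
  have "?p ^ k *\<^sub>\<int> teichmuller_monomial v k x
      = circle_frac (?p ^ k * int_monomial v x ^ CARD('p) ^ k) (?p ^ k * ?p)"
    by (simp add: teichmuller_monomial_def int_multiple_circle_frac mult.commute)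
  also have "\<dots> = circle_frac (int_monomial v x ^ CARD('p) ^ k) ?p"
    by (simp add: circle_frac_cancel)
  also have "\<dots> = circle_frac (int_monomial v x) ?p"
    by (simp add: circle_frac_eq_iff mod_ring_power_CARD_power flip: of_int_mod_ring_eq_iff)
  finally show "?p ^ k *\<^sub>\<int> teichmuller_monomial v k x = circle_frac (int_monomial v x) ?p" .
qed

lemma monomial_scale: "monomial v (c *s x) = c ^ (\<Sum>i\<in>UNIV. residue (v $ i)) * monomial v x"
  by (simp add: monomial_def power_mult_distrib prod.distrib power_sum)

text \<open>Scaling \<open>x\<close> multiplies the integer monomial by a power of \<open>|c|\<close> only modulo \<open>p\<close>;
  raising to the power \<open>p ^ k\<close> turns it into a congruence modulo the denominator \<open>p\<^sup>k\<^sup>+\<^sup>1\<close>.\<close>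

lemma homogeneous_teichmuller_monomial: "homogeneous (teichmuller_monomial v k)"
  for v :: "'p::prime_card mod_ring ^ 'n::finite"
  unfolding homogeneous_def
proof
  fix c :: "'p mod_ring"
  define s where "s = to_int_mod_ring c ^ (\<Sum>i\<in>UNIV. residue (v $ i))"
  have "teichmuller_monomial v k (c *s x) = (s ^ CARD('p) ^ k) *\<^sub>\<int> teichmuller_monomial v k x" for x
  proof -
    have "(of_int (int_monomial v (c *s x)) :: 'p mod_ring) = of_int (s * int_monomial v x)"
      by (simp add: of_int_int_monomial monomial_scale s_def)
    then have "[int_monomial v (c *s x) ^ CARD('p) ^ k = (s * int_monomial v x) ^ CARD('p) ^ k] (mod int CARD('p) ^ (k + 1))"
      unfolding of_int_mod_ring_eq_iff by (rule cong_power_lift_iterated)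
    then show ?thesis
      by (simp add: teichmuller_monomial_def int_multiple_circle_frac circle_frac_eq_iff power_mult_distrib
          del: power_Suc)
  qed
  then show "\<exists>\<sigma>. \<forall>x. teichmuller_monomial v k (c *s x) = \<sigma> *\<^sub>\<int> teichmuller_monomial v k x"
    by blast
qed

lemma teichmuller_monomial_in_nc_Poly: "v \<noteq> 0 \<Longrightarrow> teichmuller_monomial v k \<in> nc_Poly"
  unfolding nc_Poly_iff using monomial_lift_torsion[OF monomial_lift_teichmuller, of v k "Suc k"]
    monomial_lift_teichmuller unfolding monomial_lift_def by blast

text \<open>Along an enumeration of the index pairs, finitely supported families on the natural numbers
  correspond to families on pairs that vanish from some level \<open>K\<close> on.\<close>

lemma finite_support_sum_eq:
  fixes g :: "'v::finite \<Rightarrow> nat \<Rightarrow> circle" and c :: "nat \<Rightarrow> int"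
  assumes \<beta>: "bij_betw \<beta> UNIV (A \<times> UNIV)"
    and K: "\<And>b. c b \<noteq> 0 \<Longrightarrow> snd (\<beta> b) < K"
  shows "(\<Sum>b | c b \<noteq> 0. c b *\<^sub>\<int> g (fst (\<beta> b)) (snd (\<beta> b)))
    = (\<Sum>k<K. \<Sum>v\<in>A. c (inv_into UNIV \<beta> (v, k)) *\<^sub>\<int> g v k)"
proof -
  have inv: "\<beta> (inv_into UNIV \<beta> z) = z" if "z \<in> A \<times> UNIV" for z
    using \<beta> that by (metis bij_betw_imp_surj_on f_inv_into_f)
  have inv': "inv_into UNIV \<beta> (\<beta> b) = b" for b
    using \<beta> by (metis bij_betw_imp_inj_on inv_f_f)
  have inj: "inj_on (\<lambda>(k, v). inv_into UNIV \<beta> (v, k)) ({..<K} \<times> A)"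
    by (rule inj_on_inverseI[where g = "\<lambda>b. (snd (\<beta> b), fst (\<beta> b))"]) (auto simp: inv)
  have "(\<Sum>b | c b \<noteq> 0. c b *\<^sub>\<int> g (fst (\<beta> b)) (snd (\<beta> b)))
      = (\<Sum>b\<in>(\<lambda>(k, v). inv_into UNIV \<beta> (v, k)) ` ({..<K} \<times> A). c b *\<^sub>\<int> g (fst (\<beta> b)) (snd (\<beta> b)))"
  proof (rule sum.mono_neutral_left)
    show "{b. c b \<noteq> 0} \<subseteq> (\<lambda>(k, v). inv_into UNIV \<beta> (v, k)) ` ({..<K} \<times> A)"
    proof
      fix b assume "b \<in> {b. c b \<noteq> 0}"
      moreover have "\<beta> b \<in> A \<times> UNIV"
        using \<beta> bij_betwE by blast
      ultimately show "b \<in> (\<lambda>(k, v). inv_into UNIV \<beta> (v, k)) ` ({..<K} \<times> A)"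
        using K by (intro image_eqI[of _ _ "(snd (\<beta> b), fst (\<beta> b))"]) (auto simp: inv' mem_Times_iff)
    qed
  qed auto
  also have "\<dots> = (\<Sum>(k, v)\<in>{..<K} \<times> A. c (inv_into UNIV \<beta> (v, k)) *\<^sub>\<int> g v k)"
    unfolding sum.reindex[OF inj] by (rule sum.cong) (auto simp: inv)
  finally show ?thesis
    by (simp add: sum.cartesian_product)
qed

section \<open>The homogeneous basis\<close>

theorem theorem3p4:
  shows "\<exists>(B :: nat set) (h :: nat \<Rightarrow> 'p::prime_card mod_ring ^ 'n::finite \<Rightarrow> circle).
    (\<forall>b\<in>B. h b \<in> nc_Poly \<and> homogeneous (h b)) \<and>
    (\<forall>P\<in>nc_Poly. \<exists>!c :: nat \<Rightarrow> int.
      (\<forall>b\<in>B. c b \<in> {0..int CARD('p) - 1}) \<and> (\<forall>b. b \<notin> B \<longrightarrow> c b = 0) \<and>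
      finite {b. c b \<noteq> 0} \<and>
      (\<forall>x. P x = (\<Sum>b | c b \<noteq> 0. c b *\<^sub>\<int> h b x)))"
proof -
  let ?A = "- {0} :: ('p mod_ring ^ 'n) set"
  have "(\<chi> i. 1) \<in> ?A"
    by (simp add: vec_eq_iff)
  then have "infinite (?A \<times> (UNIV :: nat set))"
    by (auto simp: finite_cartesian_product_iff)
  then obtain \<beta> :: "nat \<Rightarrow> ('p mod_ring ^ 'n) \<times> nat" where \<beta>: "bij_betw \<beta> UNIV (?A \<times> UNIV)"
    using bij_betw_from_nat_into[of "?A \<times> (UNIV :: nat set)"] by (auto simp: countable_finite)
  have inv: "\<beta> (inv_into UNIV \<beta> z) = z" if "z \<in> ?A \<times> UNIV" for z
    using \<beta> that by (metis bij_betw_imp_surj_on f_inv_into_f)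
  have inv': "inv_into UNIV \<beta> (\<beta> b) = b" for b
    using \<beta> by (metis bij_betw_imp_inj_on inv_f_f)
  have \<beta>A: "fst (\<beta> b) \<in> ?A" for b
    using bij_betwE[OF \<beta>] by (auto simp: mem_Times_iff)
  define h where "h b = teichmuller_monomial (fst (\<beta> b)) (snd (\<beta> b))" for b
  have "h b \<in> nc_Poly \<and> homogeneous (h b)" for b
    using \<beta>A[of b] by (simp add: h_def teichmuller_monomial_in_nc_Poly homogeneous_teichmuller_monomial)
  moreover have "\<exists>!c :: nat \<Rightarrow> int. (\<forall>b. c b \<in> {0..int CARD('p) - 1}) \<and> finite {b. c b \<noteq> 0} \<and>
      (\<forall>x. P x = (\<Sum>b | c b \<noteq> 0. c b *\<^sub>\<int> h b x))" if nc: "P \<in> nc_Poly" for P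
  proof (rule ex_ex1I)
    obtain K where "P 0 = 0" "\<And>x. int CARD('p) ^ K *\<^sub>\<int> P x = 0"
      using nc unfolding nc_Poly_iff by blast
    then obtain c where c: "\<And>v k. c v k \<in> {0..<int CARD('p)}"
      "\<And>x. P x = (\<Sum>k<K. \<Sum>v\<in>?A. c v k *\<^sub>\<int> teichmuller_monomial v k x)"
      using digit_expansion_exists[OF monomial_lift_teichmuller, of K P] by blast
    define C where "C b = (if snd (\<beta> b) < K then c (fst (\<beta> b)) (snd (\<beta> b)) else 0)" for b
    have "{b. C b \<noteq> 0} \<subseteq> inv_into UNIV \<beta> ` (UNIV \<times> {..<K})"
    proof
      fix b assume "b \<in> {b. C b \<noteq> 0}"
      then have "\<beta> b \<in> UNIV \<times> {..<K}"
        by (auto simp: C_def mem_Times_iff split: if_splits)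
      then show "b \<in> inv_into UNIV \<beta> ` (UNIV \<times> {..<K})"
        by (intro image_eqI[of _ _ "\<beta> b"]) (simp_all only: inv')
    qed
    then have "finite {b. C b \<noteq> 0}"
      by (rule finite_subset) auto
    moreover have "P x = (\<Sum>b | C b \<noteq> 0. C b *\<^sub>\<int> h b x)" for x
    proof -
      have "(\<Sum>b | C b \<noteq> 0. C b *\<^sub>\<int> h b x)
          = (\<Sum>k<K. \<Sum>v\<in>?A. C (inv_into UNIV \<beta> (v, k)) *\<^sub>\<int> teichmuller_monomial v k x)"
        unfolding h_def
        by (rule finite_support_sum_eq[OF \<beta>, where g = "\<lambda>v k. teichmuller_monomial v k x"])
          (auto simp: C_def split: if_splits)
      also have "\<dots> = P x"
        unfolding c(2) by (intro sum.cong refl) (auto simp: C_def inv)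
      finally show ?thesis ..
    qed
    moreover have "C b \<in> {0..int CARD('p) - 1}" for b
      using c(1)[of "fst (\<beta> b)" "snd (\<beta> b)"] by (auto simp: C_def)
    ultimately show "\<exists>c :: nat \<Rightarrow> int. (\<forall>b. c b \<in> {0..int CARD('p) - 1}) \<and> finite {b. c b \<noteq> 0} \<and>
        (\<forall>x. P x = (\<Sum>b | c b \<noteq> 0. c b *\<^sub>\<int> h b x))"
      by blast
  next
    fix c c' :: "nat \<Rightarrow> int"
    assume c: "(\<forall>b. c b \<in> {0..int CARD('p) - 1}) \<and> finite {b. c b \<noteq> 0} \<and>
        (\<forall>x. P x = (\<Sum>b | c b \<noteq> 0. c b *\<^sub>\<int> h b x))"
      and c': "(\<forall>b. c' b \<in> {0..int CARD('p) - 1}) \<and> finite {b. c' b \<noteq> 0} \<and>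
        (\<forall>x. P x = (\<Sum>b | c' b \<noteq> 0. c' b *\<^sub>\<int> h b x))"
    have "finite ((\<lambda>b. snd (\<beta> b)) ` ({b. c b \<noteq> 0} \<union> {b. c' b \<noteq> 0}))"
      using c c' by blast
    then obtain K where K: "\<And>b. c b \<noteq> 0 \<or> c' b \<noteq> 0 \<Longrightarrow> snd (\<beta> b) < K"
      unfolding finite_nat_set_iff_bounded by blast
    define d where "d v k = c (inv_into UNIV \<beta> (v, k)) - c' (inv_into UNIV \<beta> (v, k))" for v k
    have expand: "(\<Sum>b | C b \<noteq> 0. C b *\<^sub>\<int> h b x)
        = (\<Sum>k<K. \<Sum>v\<in>?A. C (inv_into UNIV \<beta> (v, k)) *\<^sub>\<int> teichmuller_monomial v k x)"
      if "\<And>b. C b \<noteq> 0 \<Longrightarrow> snd (\<beta> b) < K" for C x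
      unfolding h_def using that
      by (rule finite_support_sum_eq[OF \<beta>, where g = "\<lambda>v k. teichmuller_monomial v k x"])
    have P_eq: "(\<Sum>k<K. \<Sum>v\<in>?A. c (inv_into UNIV \<beta> (v, k)) *\<^sub>\<int> teichmuller_monomial v k x) = P x"
      "(\<Sum>k<K. \<Sum>v\<in>?A. c' (inv_into UNIV \<beta> (v, k)) *\<^sub>\<int> teichmuller_monomial v k x) = P x" for x
      using c c' K expand[of c x] expand[of c' x] by metis+
    have "(\<Sum>k<K. \<Sum>v\<in>?A. d v k *\<^sub>\<int> teichmuller_monomial v k x) = P x - P x" for x
      unfolding d_def int_multiple.scale_left_diff_distrib sum_subtractf P_eq ..
    then have sum0: "(\<Sum>k<K. \<Sum>v\<in>?A. d v k *\<^sub>\<int> teichmuller_monomial v k x) = 0" for x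
      by simp
    have small: "\<bar>d v k\<bar> < int CARD('p)" for v k
    proof -
      have "c (inv_into UNIV \<beta> (v, k)) \<in> {0..int CARD('p) - 1}" "c' (inv_into UNIV \<beta> (v, k)) \<in> {0..int CARD('p) - 1}"
        using c c' by blast+
      then show ?thesis
        by (auto simp: d_def)
    qed
    show "c = c'"
    proof
      fix b
      show "c b = c' b"
      proof (cases "snd (\<beta> b) < K")
        case True
        have "fst (\<beta> b) \<noteq> 0"
          using \<beta>A[of b] by simp
        then have "d (fst (\<beta> b)) (snd (\<beta> b)) = 0"
          by (rule digit_expansion_unique[OF monomial_lift_teichmuller small sum0 True])
        then show ?thesis
          by (simp add: d_def inv')
      next
        case False
        then show ?thesis
          using K[of b] by metis
      qed
    qed
  qed
  ultimately show ?thesis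
    by (intro exI[of _ "UNIV :: nat set"] exI[of _ h]) simp
qed

end
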